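(* Let $n\geq 1$ be an integer, and let $p\in(0,1)$, $q'\in(0,1)$ and $\alpha>n$ be real numbers satisfying $$\frac{1}{p}+\frac{1}{q'}-\frac{2\alpha}{q'n}=1.$$ Then there exists a constant $C_{n,\alpha,p,q'}>0$ (depending only on $n,\alpha,p,q'$) such that $$\left|\int_{\mathbb{R}^n}\int_{\mathbb{R}^n}|x-y|^{\alpha/q'-n}\,|y|^{\alpha/q'}\,g(x)h(y)\,dx\,dy\right|\geq C_{n,\alpha,p,q'}\,\|g\|_{L^{q'}(\mathbb{R}^n)}\,\|h\|_{L^p(\mathbb{R}^n)}$$ for all nonnegative functions $g\in L^{q'}(\mathbb{R}^n)$ and $h\in L^p(\mathbb{R}^n)$.
   Context: For an exponent $t\in(0,1)$, $\|f\|_{L^t(\mathbb{R}^n)}:=\left(\int_{\mathbb{R}^n}|f(x)|^t\,dx\right)^{1/t}$, and $f\in L^t(\mathbb{R}^n)$ means that $f$ is measurable and this quantity is finite. The double integral of a nonnegative function takes values in $[0,\infty]$. *)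

theory Defs
  imports "HOL-Analysis.Analysis"
begin

text \<open>
  The spaces \<open>L\<^sup>t\<close> over the Lebesgue \<open>\<sigma>\<close>-algebra of a Euclidean space, meant for exponents
  \<open>0 < t < 1\<close>, for which \<open>Lt_norm t\<close> is not a norm.  Since \<open>Lt_norm\<close> is a real number, built from
  the Bochner integral, it carries information only for members of \<open>Lt_space t\<close>: otherwise the
  integral is \<open>0\<close> by convention.
\<close>

definition Lt_space :: "real \<Rightarrow> ('a::euclidean_space \<Rightarrow> real) set" where
  "Lt_space t = {f. f \<in> borel_measurable lebesgue \<and> integrable lebesgue (\<lambda>x. \<bar>f x\<bar> powr t)}"

definition Lt_norm :: "real \<Rightarrow> ('a::euclidean_space \<Rightarrow> real) \<Rightarrow> real" where
  "Lt_norm t f = (\<integral>x. \<bar>f x\<bar> powr t \<partial>lebesgue) powr (1 / t)"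

end

theory Submission
  imports Defs
begin

text \<open>
  Write \<open>n\<close> for the dimension, \<open>\<gamma> = \<alpha> / q' - n\<close>, \<open>\<beta> = \<alpha> / q'\<close> and \<open>q = q'\<close>, let \<open>M\<close> be the integral of
  \<open>g\<close> and \<open>G y\<close> the integral of \<open>|x - y|\<^sup>\<gamma> g x\<close>.  Take a point \<open>a\<close> that minimises \<open>G\<close> up to a factor 2
  and the length \<open>R\<close> with \<open>R\<^sup>\<gamma> M = G a\<close>.  The integral of \<open>(R + |x - a|)\<^sup>\<gamma> g x\<close> is then at most a
  multiple of \<open>R\<^sup>\<gamma> M\<close>, so the reverse Hoelder inequality gives an upper bound for the norm of \<open>g\<close>.
  Conversely \<open>|y - a| \<le> |x - y| + |x - a|\<close> and near-minimality give \<open>G y \<ge> c M (R + |y - a|)\<^sup>\<gamma>\<close>,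
  so the reverse Hoelder inequality with weight \<open>|y|\<^sup>\<beta> (R + |y - a|)\<^sup>\<gamma>\<close> bounds the norm of \<open>h\<close> by a
  multiple of the double integral.  By homogeneity \<open>M\<close> and the powers of \<open>R\<close> cancel in the product
  of the two bounds.  The hypothesis \<open>\<alpha> > n\<close> is what makes the dual powers of both weights integrable.
\<close>

section \<open>Reverse Hoelder inequality\<close>

text \<open>Young's inequality is applied pointwise to \<open>X = u x * w x / A\<close> and
  \<open>Y = w x powr - ?s / B\<close>. The exponents are dual, so the powers of \<open>w\<close>
  cancel in \<open>X powr t * Y powr (1 - t)\<close> and leave \<open>u x powr t / D\<close>; after
  integration the weights \<open>t\<close> and \<open>1 - t\<close> add up to 1. Positive upper
  bounds \<open>A\<close>, \<open>B\<close> in place of the integrals themselves avoid zero or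
  infinite normalisations.\<close>

lemma reverse_Holder:
  fixes u w :: "'a \<Rightarrow> real"
  assumes t: "0 < t" "t < 1"
    and u: "u \<in> borel_measurable M" "\<And>x. 0 \<le> u x" "integrable M (\<lambda>x. \<bar>u x\<bar> powr t)"
    and w: "w \<in> borel_measurable M" "AE x in M. 0 < w x"
    and AB: "0 < A" "0 < B"
    and uw: "(\<integral>\<^sup>+x. ennreal (u x * w x) \<partial>M) \<le> ennreal A"
    and ww: "(\<integral>\<^sup>+x. ennreal (w x powr - (t / (1 - t))) \<partial>M) \<le> ennreal B"
  shows "(\<integral>x. \<bar>u x\<bar> powr t \<partial>M) powr (1 / t) \<le> A * B powr ((1 - t) / t)"
proof -
  note [measurable] = u(1) w(1)
  define D where "D = A powr t * B powr (1 - t)"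
  have D: "0 < D" using AB by (simp add: D_def)
  let ?s = "t / (1 - t)"
  have pt: "u x powr t \<le> D * t / A * (u x * w x) + D * (1 - t) / B * (w x powr - ?s)"
    if "0 < w x" for x
  proof (cases "u x = 0")
    case True
    then show ?thesis using D t AB by simp
  next
    case False
    with u(2)[of x] have ux: "0 < u x" by simp
    define X where "X = u x * w x / A"
    define Y where "Y = w x powr - ?s / B"
    have XY: "X > 0" "Y > 0" using ux that AB by (simp_all add: X_def Y_def)
    have "X powr t * Y powr (1 - t) \<le> t * X + (1 - t) * Y"
      by (rule Youngs_inequality_0) (use t XY in auto)
    then have "D * (X powr t * Y powr (1 - t)) \<le> D * (t * X + (1 - t) * Y)"
      using D by simp
    moreover have "Y powr (1 - t) = w x powr - t / B powr (1 - t)"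
      using t by (simp add: Y_def powr_divide powr_powr)
    then have "D * (X powr t * Y powr (1 - t)) = u x powr t"
      using AB that by (simp add: D_def X_def powr_mult powr_divide powr_minus)
    ultimately show ?thesis by (simp add: X_def Y_def algebra_simps)
  qed
  have "ennreal (\<integral>x. \<bar>u x\<bar> powr t \<partial>M) = (\<integral>\<^sup>+x. ennreal (u x powr t) \<partial>M)"
    using nn_integral_eq_integral[OF u(3)] u(2) by simp
  also have "\<dots> \<le> (\<integral>\<^sup>+x. ennreal (D * t / A) * ennreal (u x * w x)
       + ennreal (D * (1 - t) / B) * ennreal (w x powr - ?s) \<partial>M)"
  proof (rule nn_integral_mono_AE, use w(2) in eventually_elim)
    fix x assume "0 < w x"
    then show "ennreal (u x powr t) \<le> ennreal (D * t / A) * ennreal (u x * w x)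
       + ennreal (D * (1 - t) / B) * ennreal (w x powr - ?s)"
      using pt[of x] D t AB u(2)[of x]
      by (simp flip: ennreal_mult ennreal_plus add: ennreal_leI)
  qed
  also have "\<dots> = ennreal (D * t / A) * (\<integral>\<^sup>+x. ennreal (u x * w x) \<partial>M)
       + ennreal (D * (1 - t) / B) * (\<integral>\<^sup>+x. ennreal (w x powr - ?s) \<partial>M)"
    by (subst nn_integral_add) (auto simp: nn_integral_cmult)
  also have "\<dots> \<le> ennreal (D * t / A) * ennreal A + ennreal (D * (1 - t) / B) * ennreal B"
    by (intro add_mono mult_left_mono uw ww) auto
  also have "\<dots> = ennreal (D * t + D * (1 - t))"
    using D t AB by (simp flip: ennreal_mult ennreal_plus)
  also have "D * t + D * (1 - t) = D" by (simp add: algebra_simps)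
  finally have "(\<integral>x. \<bar>u x\<bar> powr t \<partial>M) \<le> D" using D by simp
  then have "(\<integral>x. \<bar>u x\<bar> powr t \<partial>M) powr (1 / t) \<le> D powr (1 / t)"
    using t by (intro powr_mono2) auto
  also have "\<dots> = A * B powr ((1 - t) / t)"
    using AB t by (simp add: D_def powr_mult powr_powr)
  finally show ?thesis .
qed

section \<open>Integrals of power kernels\<close>

lemma dyadic_bracket:
  fixes t :: real
  assumes "1 \<le> t"
  obtains k :: nat where "2 ^ k \<le> t" "t \<le> 2 ^ Suc k"
proof -
  define k where "k = nat \<lfloor>log 2 t\<rfloor>"
  have 0: "0 \<le> log 2 t" using assms by simp
  have "real k \<le> log 2 t" "log 2 t \<le> real (Suc k)"
    using 0 by (auto simp: k_def) linarith
  then have "2 powr real k \<le> t" "t \<le> 2 powr real (Suc k)"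
    using assms by (simp_all add: le_log_iff log_le_iff)
  then show ?thesis by (intro that[of k]) (simp_all add: powr_realpow del: of_nat_Suc)
qed

text \<open>Space is cut at distance \<open>R\<close> from \<open>c\<close> and decomposed
  dyadically on both sides. The inner series is geometric with ratio \<open>p < 1\<close> because
  \<mu> is below the dimension, the outer one with ratio \<open>q < 1\<close> because
  \<open>\<mu> + \<nu>\<close> is above it. Every term scales in \<open>R\<close> with the same
  power. Full balls can replace shells, since only an upper bound is wanted.\<close>

lemma nn_integral_radial_kernel_le:
  fixes \<mu> \<nu> :: real
  assumes \<mu>: "0 \<le> \<mu>" "\<mu> < DIM('a)" and \<nu>: "DIM('a) < \<mu> + \<nu>"
  obtains K where "K > 0"
    "\<And>R (c :: 'a :: euclidean_space). R > 0 \<Longrightarrow>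
      (\<integral>\<^sup>+y. ennreal (norm (y - c) powr - \<mu> * (R + norm (y - c)) powr - \<nu>) \<partial>lborel)
        \<le> ennreal (K * R powr (DIM('a) - \<mu> - \<nu>))"
proof -
  let ?n = "DIM('a)"
  define \<omega> where "\<omega> = unit_ball_vol ?n"
  have \<omega>: "\<omega> > 0" by (simp add: \<omega>_def)
  have \<nu>0: "\<nu> > 0" using \<mu> \<nu> by linarith
  have le_suminf: "f k \<le> (\<Sum>k. f k)" for f :: "nat \<Rightarrow> ennreal" and k
    using sum_le_suminf[OF summableI, of "{k}" f] by simp
  define p where "p = 2 powr (\<mu> - ?n)"
  define q where "q = 2 powr (?n - \<mu> - \<nu>)"
  have p: "0 < p" "p < 1" using \<mu> by (simp_all add: p_def powr_less_one)
  have q: "0 < q" "q < 1" using \<nu> by (simp_all add: q_def powr_less_one)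
  define K where "K = \<omega> * 2 powr \<mu> / (1 - p) + \<omega> * 2 ^ ?n / (1 - q)"
  have K: "K > 0" using \<omega> p q by (simp add: K_def add_pos_pos)
  show thesis
  proof (rule that[OF K])
    fix R :: real and c :: 'a
    assume R: "R > 0"
    let ?E = "R powr (?n - \<mu> - \<nu>)"
    let ?f = "\<lambda>y. norm (y - c) powr - \<mu> * (R + norm (y - c)) powr - \<nu>"
    \<comment> \<open>\<open>a k\<close> bounds the kernel at distances between
      \<open>R / 2 ^ Suc k\<close> and \<open>R / 2 ^ k\<close>, where
      \<open>R + norm (y - c)\<close> is estimated below by \<open>R\<close>; \<open>b k\<close>
      bounds it between \<open>R * 2 ^ k\<close> and \<open>R * 2 ^ Suc k\<close>, where it is
      estimated below by \<open>norm (y - c)\<close>.\<close>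
    define a where "a k = (R / 2 ^ Suc k) powr - \<mu> * R powr - \<nu>" for k :: nat
    define b where "b k = (R * 2 ^ k) powr (- \<mu> - \<nu>)" for k :: nat
    define S where "S k = cball c (R / 2 ^ k)" for k :: nat
    define T where "T k = cball c (R * 2 ^ Suc k)" for k :: nat
    have [measurable]: "S k \<in> sets borel" "T k \<in> sets borel" for k
      by (auto simp: S_def T_def)
    \<comment> \<open>The balls \<open>S k\<close> resolve the singularity at \<open>c\<close>, the balls \<open>T k\<close> the tail at infinity.\<close>
    have pt: "ennreal (?f y) \<le> (\<Sum>k. ennreal (a k) * indicator (S k) y)
        + (\<Sum>k. ennreal (b k) * indicator (T k) y)" (is "_ \<le> ?A + ?B") for y
    \<comment> \<open>At \<open>y = c\<close> the left side is 0, because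
      \<open>0 powr z = 0\<close> for every \<open>z\<close>.\<close>
    proof (cases "y = c")
      case False
      define x where "x = norm (y - c)"
      have x: "x > 0" using False by (simp add: x_def)
      show ?thesis
      proof (cases "x \<le> R")
        case True
        then have "1 \<le> R / x" using x by simp
        then obtain k where k: "2 ^ k \<le> R / x" "R / x \<le> 2 ^ Suc k" by (rule dyadic_bracket)
        have "?f y \<le> a k" unfolding a_def x_def[symmetric]
          by (intro mult_mono powr_mono2') (use x R k \<mu> \<nu>0 in \<open>auto simp: field_simps\<close>)
        moreover have "y \<in> S k"
          using k x by (auto simp: S_def x_def dist_norm norm_minus_commute field_simps)
        ultimately have "ennreal (?f y) \<le> ennreal (a k) * indicator (S k) y"
          by (simp add: ennreal_leI)
        also have "\<dots> \<le> ?A"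
          by (rule le_suminf)
        also have "\<dots> \<le> ?A + ?B" by simp
        finally show ?thesis .
      next
        case False
        then have "1 \<le> x / R" using R by simp
        then obtain k where k: "2 ^ k \<le> x / R" "x / R \<le> 2 ^ Suc k" by (rule dyadic_bracket)
        have "?f y \<le> x powr - \<mu> * x powr - \<nu>" unfolding x_def[symmetric]
          by (intro mult_mono powr_mono2') (use x R \<mu> \<nu>0 in auto)
        also have "\<dots> = x powr (- \<mu> - \<nu>)" by (simp flip: powr_add)
        also have "\<dots> \<le> b k" unfolding b_def
          by (intro powr_mono2') (use x R k \<mu> \<nu>0 in \<open>auto simp: field_simps\<close>)
        finally have "?f y \<le> b k" .
        moreover have "y \<in> T k"
          using k x R by (auto simp: T_def x_def dist_norm norm_minus_commute field_simps)
        ultimately have "ennreal (?f y) \<le> ennreal (b k) * indicator (T k) y"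
          by (simp add: ennreal_leI)
        also have "\<dots> \<le> ?B"
          by (rule le_suminf)
        also have "\<dots> \<le> ?A + ?B" by simp
        finally show ?thesis .
      qed
    qed auto
    have a_nonneg: "0 \<le> a k" and b_nonneg: "0 \<le> b k" for k
      by (simp_all add: a_def b_def)
    have eq1: "a k * (\<omega> * (R / 2 ^ k) ^ ?n) = \<omega> * 2 powr \<mu> * ?E * p ^ k" for k
      using R by (simp add: a_def p_def powr_divide powr_mult powr_minus powr_diff powr_powr
          flip: powr_realpow) (simp add: field_simps powr_add powr_mult powr_diff powr_powr)
    have eq2: "b k * (\<omega> * (R * 2 ^ Suc k) ^ ?n) = \<omega> * 2 ^ ?n * ?E * q ^ k" for k
      using R by (simp add: b_def q_def powr_divide powr_mult powr_minus powr_diff powr_powr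
          flip: powr_realpow) (simp add: field_simps powr_add powr_mult powr_diff powr_powr)
    have "(\<integral>\<^sup>+y. ennreal (?f y) \<partial>lborel) \<le>
       (\<integral>\<^sup>+y. (\<Sum>k. ennreal (a k) * indicator (S k) y)
        + (\<Sum>k. ennreal (b k) * indicator (T k) y) \<partial>lborel)"
      by (intro nn_integral_mono pt)
    also have "\<dots> = (\<Sum>k. ennreal (a k) * emeasure lborel (S k))
        + (\<Sum>k. ennreal (b k) * emeasure lborel (T k))"
      by (simp add: nn_integral_add nn_integral_suminf nn_integral_cmult_indicator)
    also have "(\<lambda>k. ennreal (a k) * emeasure lborel (S k)) = (\<lambda>k. ennreal (\<omega> * 2 powr \<mu> * ?E * p ^ k))"
      using R \<omega> by (simp add: S_def emeasure_cball a_nonneg ennreal_mult[symmetric] eq1 flip: \<omega>_def)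
    also have "(\<lambda>k. ennreal (b k) * emeasure lborel (T k)) = (\<lambda>k. ennreal (\<omega> * 2 ^ ?n * ?E * q ^ k))"
      using R \<omega> by (simp add: T_def emeasure_cball b_nonneg ennreal_mult[symmetric] eq2 flip: \<omega>_def del: power_Suc)
    also have "(\<Sum>k. ennreal (\<omega> * 2 powr \<mu> * ?E * p ^ k)) = ennreal (\<omega> * 2 powr \<mu> * ?E * (1 / (1 - p)))"
      by (intro suminf_ennreal_eq sums_mult geometric_sums) (use p \<omega> in auto)
    also have "(\<Sum>k. ennreal (\<omega> * 2 ^ ?n * ?E * q ^ k)) = ennreal (\<omega> * 2 ^ ?n * ?E * (1 / (1 - q)))"
      by (intro suminf_ennreal_eq sums_mult geometric_sums) (use q \<omega> in auto)
    also have "ennreal (\<omega> * 2 powr \<mu> * ?E * (1 / (1 - p))) + ennreal (\<omega> * 2 ^ ?n * ?E * (1 / (1 - q)))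
       = ennreal (K * ?E)"
      using p q \<omega> by (simp add: K_def algebra_simps flip: ennreal_plus)
    finally show "(\<integral>\<^sup>+y. ennreal (?f y) \<partial>lborel) \<le> ennreal (K * ?E)" .
  qed
qed

text \<open>The bound does not depend on \<open>a\<close>: the smaller of the two distances can serve in both factors.\<close>
lemma nn_integral_two_center_kernel_le:
  fixes \<mu> \<nu> :: real
  assumes \<mu>: "0 \<le> \<mu>" "\<mu> < DIM('a)" and \<nu>: "DIM('a) < \<mu> + \<nu>"
  obtains K where "K > 0"
    "\<And>R (a :: 'a :: euclidean_space). R > 0 \<Longrightarrow>
      (\<integral>\<^sup>+y. ennreal (norm y powr - \<mu> * (R + norm (y - a)) powr - \<nu>) \<partial>lborel)
        \<le> ennreal (K * R powr (DIM('a) - \<mu> - \<nu>))"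
proof -
  let ?f = "\<lambda>R x. x powr - \<mu> * (R + x) powr - \<nu>"
  obtain K where K: "K > 0" and le: "\<And>R (c :: 'a). R > 0 \<Longrightarrow>
      (\<integral>\<^sup>+y. ennreal (?f R (norm (y - c))) \<partial>lborel) \<le> ennreal (K * R powr (DIM('a) - \<mu> - \<nu>))"
    using nn_integral_radial_kernel_le[OF \<mu> \<nu>] by blast
  show thesis
  proof (rule that[of "2 * K"])
    fix R :: real and a :: 'a
    assume R: "R > 0"
    \<comment> \<open>The point \<open>a\<close> is excluded: there
      \<open>0 powr - \<mu> = 0\<close> removes the summand centred at \<open>a\<close>, and the
      bound can fail. A single point is a null set.\<close>
    have pt: "norm y powr - \<mu> * (R + norm (y - a)) powr - \<nu> \<le> ?f R (norm (y - 0)) + ?f R (norm (y - a))"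
      if "y \<noteq> a" for y
    proof (cases "norm y \<le> norm (y - a)")
      case True
      then have "norm y powr - \<mu> * (R + norm (y - a)) powr - \<nu> \<le> ?f R (norm (y - 0))"
        using \<mu> \<nu> R by (cases "y = 0") (auto simp: add_pos_nonneg intro!: mult_left_mono powr_mono2')
      then show ?thesis by (smt (verit) mult_nonneg_nonneg powr_ge_zero)
    next
      case False
      then have "norm y powr - \<mu> * (R + norm (y - a)) powr - \<nu> \<le> ?f R (norm (y - a))"
        using \<mu> \<nu> R that by (intro mult_mono powr_mono2') (auto simp: add_pos_nonneg)
      then show ?thesis by (smt (verit) mult_nonneg_nonneg powr_ge_zero)
    qed
    have "(\<integral>\<^sup>+y. ennreal (norm y powr - \<mu> * (R + norm (y - a)) powr - \<nu>) \<partial>lborel)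
       \<le> (\<integral>\<^sup>+y. ennreal (?f R (norm (y - (0 :: 'a)))) + ennreal (?f R (norm (y - a))) \<partial>lborel)"
      by (rule nn_integral_mono_AE, rule AE_mp[OF AE_lborel_singleton[of a]])
         (auto simp flip: ennreal_plus intro!: ennreal_leI pt[simplified])
    also have "\<dots> = (\<integral>\<^sup>+y. ennreal (?f R (norm (y - (0 :: 'a)))) \<partial>lborel)
         + (\<integral>\<^sup>+y. ennreal (?f R (norm (y - a))) \<partial>lborel)"
      by (simp add: nn_integral_add)
    also have "\<dots> \<le> ennreal (K * R powr (DIM('a) - \<mu> - \<nu>)) + ennreal (K * R powr (DIM('a) - \<mu> - \<nu>))"
      by (intro add_mono le R)
    also have "\<dots> = ennreal (2 * K * R powr (DIM('a) - \<mu> - \<nu>))"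
      using K by (simp flip: ennreal_plus)
    finally show "(\<integral>\<^sup>+y. ennreal (norm y powr - \<mu> * (R + norm (y - a)) powr - \<nu>) \<partial>lborel)
        \<le> ennreal (2 * K * R powr (DIM('a) - \<mu> - \<nu>))" .
  qed (use K in simp)
qed

section \<open>Bounding \<open>Lt_norm\<close> by a weighted integral\<close>

lemma Lt_norm_eq_0_AE:
  assumes "AE x in lebesgue. u x = 0"
  shows "Lt_norm t u = 0"
proof -
  have "(\<integral>x. \<bar>u x\<bar> powr t \<partial>lebesgue) = 0"
    using assms by (intro integral_eq_zero_AE) auto
  then show ?thesis by (simp add: Lt_norm_def)
qed

text \<open>Reverse Hoelder with weight
  \<open>norm y powr \<beta> * (R + norm (y - a)) powr \<gamma>\<close>. With
  \<open>s = t / (1 - t)\<close>, so that \<open>1 / t - 1 = 1 / s\<close>, the two strict bounds on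
  the exponents say that the weight to the power \<open>- s\<close> is integrable at the origin and
  at infinity respectively.\<close>

lemma Lt_norm_le_weighted_integral:
  fixes \<beta> \<gamma> t :: real
  assumes t: "0 < t" "t < 1" and \<beta>: "0 \<le> \<beta>" "\<beta> < DIM('a) * (1 / t - 1)"
    and \<gamma>: "DIM('a) * (1 / t - 1) < \<beta> + \<gamma>"
  obtains K where "K > 0"
    "\<And>R A (a :: 'a :: euclidean_space) u. R > 0 \<Longrightarrow> A > 0 \<Longrightarrow> u \<in> Lt_space t \<Longrightarrow> (\<And>x. 0 \<le> u x) \<Longrightarrow>
      (\<integral>\<^sup>+y. ennreal (norm y powr \<beta> * (R + norm (y - a)) powr \<gamma> * u y) \<partial>lebesgue) \<le> ennreal A \<Longrightarrow>
      Lt_norm t u \<le> K * A * R powr (DIM('a) * (1 / t - 1) - \<beta> - \<gamma>)"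
proof -
  let ?n = "real DIM('a)"
  define s where "s = t / (1 - t)"
  have s: "0 < s" "1 / t - 1 = 1 / s" using t by (simp_all add: s_def field_simps)
  have "0 \<le> \<beta> * s" "\<beta> * s < ?n" "?n < \<beta> * s + \<gamma> * s"
    using \<beta> \<gamma> s by (simp_all add: field_simps)
  then obtain K where K: "K > 0" and le: "\<And>R (a :: 'a). R > 0 \<Longrightarrow>
      (\<integral>\<^sup>+y. ennreal (norm y powr - (\<beta> * s) * (R + norm (y - a)) powr - (\<gamma> * s)) \<partial>lborel)
        \<le> ennreal (K * R powr (?n - \<beta> * s - \<gamma> * s))"
    by (rule nn_integral_two_center_kernel_le) blast
  show thesis
  proof (rule that[of "K powr (1 / s)"])
    fix R A :: real and a :: 'a and u :: "'a \<Rightarrow> real"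
    assume R: "R > 0" and A: "A > 0" and u: "u \<in> Lt_space t" "\<And>x. 0 \<le> u x"
      and int: "(\<integral>\<^sup>+y. ennreal (norm y powr \<beta> * (R + norm (y - a)) powr \<gamma> * u y) \<partial>lebesgue) \<le> ennreal A"
    define w where "w y = norm y powr \<beta> * (R + norm (y - a)) powr \<gamma>" for y
    define B where "B = K * R powr (?n - \<beta> * s - \<gamma> * s)"
    have "(\<integral>x. \<bar>u x\<bar> powr t \<partial>lebesgue) powr (1 / t) \<le> A * B powr ((1 - t) / t)"
    proof (rule reverse_Holder[where w = w])
      show "u \<in> borel_measurable lebesgue" "integrable lebesgue (\<lambda>x. \<bar>u x\<bar> powr t)"
        using u(1) by (auto simp: Lt_space_def)
      have "w \<in> borel_measurable borel" unfolding w_def by measurable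
      then show "w \<in> borel_measurable lebesgue" by (simp add: measurable_completion)
      \<comment> \<open>The weight vanishes at the origin even for \<open>\<beta> = 0\<close>, as
        \<open>0 powr 0 = 0\<close>; hence positivity only almost everywhere.\<close>
      have "0 < w y" if "y \<noteq> 0" for y
        using that add_pos_nonneg[OF R norm_ge_zero[of "y - a"]] by (simp add: w_def)
      moreover have "AE y :: 'a in lebesgue. y \<noteq> 0"
        by (rule AE_completion[OF AE_lborel_singleton])
      ultimately show "AE y in lebesgue. 0 < w y"
        by (auto elim!: eventually_mono)
      have "w y powr - s = norm y powr - (\<beta> * s) * (R + norm (y - a)) powr - (\<gamma> * s)" for y
        by (simp add: w_def powr_mult powr_powr)
      then show "(\<integral>\<^sup>+y. ennreal (w y powr - (t / (1 - t))) \<partial>lebesgue) \<le> ennreal B"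
        using le[OF R, of a] by (simp add: nn_integral_completion B_def flip: s_def)
      show "(\<integral>\<^sup>+y. ennreal (u y * w y) \<partial>lebesgue) \<le> ennreal A"
        using int by (simp add: w_def mult_ac)
    qed (use t u(2) A K R in \<open>auto simp: B_def\<close>)
    also have "(1 - t) / t = 1 / s" by (simp add: s_def)
    also have "B powr (1 / s) = K powr (1 / s) * R powr (?n * (1 / t - 1) - \<beta> - \<gamma>)"
      using s by (simp add: B_def powr_mult powr_powr diff_divide_distrib)
    finally show "Lt_norm t u \<le> K powr (1 / s) * A * R powr (?n * (1 / t - 1) - \<beta> - \<gamma>)"
      by (simp add: Lt_norm_def mult_ac)
  qed (use K in simp)
qed

section \<open>Pointwise estimates for the potential of \<open>g\<close>\<close>

lemma powr_add_le:
  fixes x y \<gamma> :: real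
  assumes "0 \<le> x" "0 \<le> y" "0 \<le> \<gamma>"
  shows "(x + y) powr \<gamma> \<le> 2 powr \<gamma> * (x powr \<gamma> + y powr \<gamma>)"
proof -
  have "(x + y) powr \<gamma> \<le> (2 * max x y) powr \<gamma>"
    using assms by (intro powr_mono2) auto
  also have "\<dots> = 2 powr \<gamma> * max x y powr \<gamma>" by (rule powr_mult)
  also have "\<dots> \<le> 2 powr \<gamma> * (x powr \<gamma> + y powr \<gamma>)"
    by (intro mult_left_mono) (auto simp: max_def)
  finally show ?thesis .
qed

text \<open>The unnormalised Riesz potential of order \<gamma> plus the dimension; for positive
  \<gamma> the kernel grows instead of being singular. It takes extended values because finiteness
  at a point has to be proved.\<close>

definition riesz_potential :: "real \<Rightarrow> ('a::euclidean_space \<Rightarrow> real) \<Rightarrow> 'a \<Rightarrow> ennreal" where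
  "riesz_potential \<gamma> g y = (\<integral>\<^sup>+x. ennreal (norm (x - y) powr \<gamma> * g x) \<partial>lebesgue)"

lemma weighted_integral_le_riesz_potential:
  fixes R \<gamma> :: real
  assumes [measurable]: "g \<in> borel_measurable lebesgue" and g: "\<And>x. 0 \<le> g x"
    and "0 \<le> R" "0 \<le> \<gamma>"
  shows "(\<integral>\<^sup>+x. ennreal ((R + norm (x - a)) powr \<gamma> * g x) \<partial>lebesgue)
    \<le> ennreal (2 powr \<gamma>) * (ennreal (R powr \<gamma>) * (\<integral>\<^sup>+x. ennreal (g x) \<partial>lebesgue) + riesz_potential \<gamma> g a)"
proof -
  have [measurable]: "(\<lambda>x. norm (x - a)) \<in> borel_measurable lebesgue"
    by (intro measurable_completion) simp
  have "(\<integral>\<^sup>+x. ennreal ((R + norm (x - a)) powr \<gamma> * g x) \<partial>lebesgue)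
     \<le> (\<integral>\<^sup>+x. ennreal (2 powr \<gamma>) * (ennreal (R powr \<gamma>) * ennreal (g x) + ennreal (norm (x - a) powr \<gamma> * g x)) \<partial>lebesgue)"
  proof (rule nn_integral_mono)
    fix x
    have "(R + norm (x - a)) powr \<gamma> * g x \<le> 2 powr \<gamma> * (R powr \<gamma> + norm (x - a) powr \<gamma>) * g x"
      using assms by (intro mult_right_mono powr_add_le) auto
    then show "ennreal ((R + norm (x - a)) powr \<gamma> * g x)
      \<le> ennreal (2 powr \<gamma>) * (ennreal (R powr \<gamma>) * ennreal (g x) + ennreal (norm (x - a) powr \<gamma> * g x))"
      using g[of x] by (simp add: algebra_simps ennreal_leI flip: ennreal_mult ennreal_plus)
  qed
  also have "\<dots> = ennreal (2 powr \<gamma>) * (ennreal (R powr \<gamma>) * (\<integral>\<^sup>+x. ennreal (g x) \<partial>lebesgue) + riesz_potential \<gamma> g a)"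
    by (simp add: nn_integral_cmult nn_integral_add riesz_potential_def)
  finally show ?thesis .
qed

text \<open>The triangle inequality through \<open>x\<close>, integrated against \<open>g\<close>.
  It serves twice: finiteness of the potential at two distinct points makes the mass of
  \<open>g\<close> finite, and the potential must grow away from a near-minimiser.\<close>

lemma riesz_potential_two_points:
  fixes \<gamma> :: real
  assumes [measurable]: "g \<in> borel_measurable lebesgue" and g: "\<And>x. 0 \<le> g x" and "0 \<le> \<gamma>"
  shows "ennreal (norm (y - z) powr \<gamma>) * (\<integral>\<^sup>+x. ennreal (g x) \<partial>lebesgue)
    \<le> ennreal (2 powr \<gamma>) * (riesz_potential \<gamma> g y + riesz_potential \<gamma> g z)"
proof -
  have [measurable]: "(\<lambda>x. norm (x - a)) \<in> borel_measurable lebesgue" for a :: 'a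
    by (intro measurable_completion) simp
  have "ennreal (norm (y - z) powr \<gamma>) * (\<integral>\<^sup>+x. ennreal (g x) \<partial>lebesgue)
     = (\<integral>\<^sup>+x. ennreal (norm (y - z) powr \<gamma> * g x) \<partial>lebesgue)"
    using g by (simp add: ennreal_mult nn_integral_cmult)
  also have "\<dots> \<le> (\<integral>\<^sup>+x. ennreal (2 powr \<gamma>) * (ennreal (norm (x - y) powr \<gamma> * g x) + ennreal (norm (x - z) powr \<gamma> * g x)) \<partial>lebesgue)"
  proof (rule nn_integral_mono)
    fix x
    have "norm (y - z) powr \<gamma> \<le> (norm (x - y) + norm (x - z)) powr \<gamma>"
      using assms norm_triangle_ineq4[of "x - z" "x - y"] by (intro powr_mono2) (auto simp: algebra_simps)
    also have "\<dots> \<le> 2 powr \<gamma> * (norm (x - y) powr \<gamma> + norm (x - z) powr \<gamma>)"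
      using assms by (intro powr_add_le) auto
    finally have "norm (y - z) powr \<gamma> * g x \<le> 2 powr \<gamma> * (norm (x - y) powr \<gamma> + norm (x - z) powr \<gamma>) * g x"
      using g[of x] by (rule mult_right_mono)
    then show "ennreal (norm (y - z) powr \<gamma> * g x)
      \<le> ennreal (2 powr \<gamma>) * (ennreal (norm (x - y) powr \<gamma> * g x) + ennreal (norm (x - z) powr \<gamma> * g x))"
      using g[of x] by (simp add: algebra_simps ennreal_leI flip: ennreal_mult ennreal_plus)
  qed
  also have "\<dots> = ennreal (2 powr \<gamma>) * (riesz_potential \<gamma> g y + riesz_potential \<gamma> g z)"
    by (simp add: nn_integral_cmult nn_integral_add riesz_potential_def)
  finally show ?thesis .
qed

section \<open>The inequality for general exponents\<close>

lemma reversed_Stein_Weiss: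
  fixes p q \<gamma> \<beta> :: real
  assumes p: "0 < p" "p < 1" and q: "0 < q" "q < 1" and \<gamma>: "0 < \<gamma>"
    and \<beta>: "0 \<le> \<beta>" "\<beta> < DIM('a) * (1 / p - 1)"
    and hom: "DIM('a) * (1 / p - 1) + DIM('a) * (1 / q - 1) = \<beta> + \<gamma>"
  obtains C where "C > 0"
    "\<And>g h :: 'a :: euclidean_space \<Rightarrow> real.
      g \<in> Lt_space q \<Longrightarrow> h \<in> Lt_space p \<Longrightarrow> (\<And>x. 0 \<le> g x) \<Longrightarrow> (\<And>y. 0 \<le> h y) \<Longrightarrow>
      ennreal (C * Lt_norm q g * Lt_norm p h) \<le>
      (\<integral>\<^sup>+y. (\<integral>\<^sup>+x. ennreal (norm (x - y) powr \<gamma> * norm y powr \<beta> * g x * h y) \<partial>lebesgue) \<partial>lebesgue)"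
proof -
  \<comment> \<open>\<open>e\<close> governs the powers of \<open>R\<close> in both norm bounds:
    \<open>e - \<gamma>\<close> for \<open>g\<close> and, by \<open>hom\<close>, \<open>- e\<close>
    for \<open>h\<close>. The upper bound on \<beta> becomes \<open>e < \<gamma>\<close>.\<close>
  define e where "e = DIM('a) * (1 / q - 1)"
  have "0 < e" using q by (simp add: e_def)
  then have e: "0 < e" "e < 0 + \<gamma>" and ep: "DIM('a) * (1 / p - 1) - \<beta> - \<gamma> = - e"
    "DIM('a) * (1 / p - 1) < \<beta> + \<gamma>"
    using hom \<beta> unfolding e_def by linarith+
  obtain K1 where K1: "K1 > 0" and le1: "\<And>R A (a :: 'a) u. R > 0 \<Longrightarrow> A > 0 \<Longrightarrow> u \<in> Lt_space q \<Longrightarrow> (\<And>x. 0 \<le> u x) \<Longrightarrow>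
      (\<integral>\<^sup>+y. ennreal (norm y powr 0 * (R + norm (y - a)) powr \<gamma> * u y) \<partial>lebesgue) \<le> ennreal A \<Longrightarrow>
      Lt_norm q u \<le> K1 * A * R powr (e - 0 - \<gamma>)"
    using Lt_norm_le_weighted_integral[where 'a = 'a, OF q order_refl e[unfolded e_def], folded e_def] by blast
  obtain K2 where K2: "K2 > 0" and le2: "\<And>R A (a :: 'a) u. R > 0 \<Longrightarrow> A > 0 \<Longrightarrow> u \<in> Lt_space p \<Longrightarrow> (\<And>x. 0 \<le> u x) \<Longrightarrow>
      (\<integral>\<^sup>+y. ennreal (norm y powr \<beta> * (R + norm (y - a)) powr \<gamma> * u y) \<partial>lebesgue) \<le> ennreal A \<Longrightarrow>
      Lt_norm p u \<le> K2 * A * R powr - e"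
    using Lt_norm_le_weighted_integral[where 'a = 'a, OF p \<beta> ep(2), unfolded ep(1)] by blast
  \<comment> \<open>\<open>c\<close> is the constant in the lower bound \<open>low\<close> below. In
    \<open>C\<close>, the factor 4 is a 2 from the two equal terms in the bound for \<open>N\<close>
    times a 2 that makes the final estimate \<open>N * H \<le> N * H / 2\<close>.\<close>
  define c where "c = 1 / (5 * 4 powr \<gamma>)"
  have c: "c > 0" by (simp add: c_def)
  define C where "C = c / (4 * K1 * K2 * 2 powr \<gamma>)"
  have C: "C > 0" using c K1 K2 by (simp add: C_def)
  show thesis
  proof (rule that[OF C])
    fix g h :: "'a \<Rightarrow> real"
    assume g: "g \<in> Lt_space q" and h: "h \<in> Lt_space p"
      and g0: "\<And>x. 0 \<le> g x" and h0: "\<And>y. 0 \<le> h y"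
    have meas [measurable]: "g \<in> borel_measurable lebesgue" "h \<in> borel_measurable lebesgue"
      using g h by (auto simp: Lt_space_def)
    have [measurable]: "(\<lambda>x :: 'a. norm x) \<in> borel_measurable lebesgue"
        "(\<lambda>x. norm (x - a)) \<in> borel_measurable lebesgue" for a :: 'a
      by (auto intro!: measurable_completion)
    let ?J = "\<lambda>y. \<integral>\<^sup>+x. ennreal (norm (x - y) powr \<gamma> * norm y powr \<beta> * g x * h y) \<partial>lebesgue"
    let ?I = "\<integral>\<^sup>+y. ?J y \<partial>lebesgue"
    define G where "G = riesz_potential \<gamma> g"
    define N where "N = Lt_norm q g"
    define H where "H = Lt_norm p h"
    have NH: "0 \<le> N" "0 \<le> H" by (simp_all add: N_def H_def Lt_norm_def)
    have J: "?J y = ennreal (norm y powr \<beta> * h y) * G y" for y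
    proof -
      have "?J y = (\<integral>\<^sup>+x. ennreal (norm y powr \<beta> * h y) * ennreal (norm (x - y) powr \<gamma> * g x) \<partial>lebesgue)"
        using g0 h0 by (simp add: mult_ac flip: ennreal_mult)
      then show ?thesis by (simp add: nn_integral_cmult G_def riesz_potential_def)
    qed
    show "ennreal (C * Lt_norm q g * Lt_norm p h) \<le> ?I"
    proof (rule ccontr)
      define A where "A = C * N * H"
      \<comment> \<open>The negation yields a finite double integral and positive \<open>N\<close>
        and \<open>H\<close>, which disposes of all degenerate cases.\<close>
      assume "\<not> ?thesis"
      then have IA: "?I < ennreal A" by (simp add: A_def N_def H_def not_le)
      then have "A > 0" using le_less_trans[OF zero_le IA] by simp
      then have N: "N > 0" and H: "H > 0"
        using NH C by (auto simp: A_def zero_less_mult_iff)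
      \<comment> \<open>If \<open>G\<close> were finite at no more than one point, the inner
        integral would be infinite at almost every point where \<open>h\<close> is positive, so
        \<open>h\<close> would vanish almost everywhere, against \<open>H > 0\<close>.\<close>
      obtain y z where yz: "y \<noteq> z" "G y < \<infinity>" "G z < \<infinity>"
      proof (rule ccontr)
        assume "\<not> thesis"
        then have *: "y = z" if "G y < \<infinity>" "G z < \<infinity>" for y z
          using that \<open>\<And>z y. y \<noteq> z \<Longrightarrow> G y < \<infinity> \<Longrightarrow> G z < \<infinity> \<Longrightarrow> thesis\<close> by blast
        obtain y0 where y0: "G y = \<infinity>" if "y \<noteq> y0" for y
          using * by (metis infinity_ennreal_def less_top)
        let ?S = "{y \<in> space lebesgue. 0 < h y}"
        have S: "?S \<in> sets lebesgue" by measurable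
        have "\<infinity> * emeasure lebesgue ?S = (\<integral>\<^sup>+y. \<infinity> * indicator ?S y \<partial>lebesgue)"
          by (rule nn_integral_cmult_indicator[OF S, symmetric])
        also have "\<dots> \<le> ?I"
        proof (rule nn_integral_mono_AE)
          have "AE y in lebesgue. y \<noteq> 0 \<and> y \<noteq> y0"
            using AE_completion[OF AE_lborel_singleton] by auto
          then show "AE y in lebesgue. \<infinity> * indicator ?S y \<le> ?J y"
          proof eventually_elim
            case (elim y)
            then show ?case
              unfolding J using y0[of y] by (auto simp: indicator_def ennreal_mult_top)
          qed
        qed
        also have "\<dots> < \<infinity>" using IA by (auto intro: less_trans)
        finally have "emeasure lebesgue ?S = 0"
          by (auto simp: ennreal_top_mult split: if_splits)
        then have "AE y in lebesgue. \<not> 0 < h y"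
          using S by (subst AE_iff_measurable[where N = ?S]) auto
        then have "AE y in lebesgue. h y = 0"
          by eventually_elim (use h0 in \<open>simp add: order_antisym not_less\<close>)
        then show False using Lt_norm_eq_0_AE[of h p] H by (simp add: H_def)
      qed
      have Mfin: "(\<integral>\<^sup>+x. ennreal (g x) \<partial>lebesgue) < \<infinity>"
      proof -
        have "ennreal (norm (y - z) powr \<gamma>) * (\<integral>\<^sup>+x. ennreal (g x) \<partial>lebesgue)
          \<le> ennreal (2 powr \<gamma>) * (G y + G z)"
          unfolding G_def by (rule riesz_potential_two_points) (use meas g0 \<gamma> in auto)
        also have "\<dots> < \<infinity>" using yz by (simp add: ennreal_mult_less_top)
        finally show ?thesis using yz(1) by (auto simp: ennreal_mult_less_top)
      qed
      define M where "M = enn2real (\<integral>\<^sup>+x. ennreal (g x) \<partial>lebesgue)"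
      have M: "(\<integral>\<^sup>+x. ennreal (g x) \<partial>lebesgue) = ennreal M"
        using Mfin by (simp add: M_def)
      have "M \<noteq> 0"
      proof
        assume "M = 0"
        then have "AE x in lebesgue. g x = 0"
          using M g0 by (simp add: nn_integral_0_iff_AE ennreal_eq_0_iff) (auto elim!: eventually_mono simp: order_antisym)
        then show False using Lt_norm_eq_0_AE[of g q] N by (simp add: N_def)
      qed
      then have M0: "M > 0" by (simp add: M_def order_less_le)
      \<comment> \<open>\<open>R\<close> stays free because two choices of it follow. A positive
        upper bound \<open>v\<close> replaces \<open>G a\<close>, which is not yet known to be
        nonzero.\<close>
      have N_le: "N \<le> K1 * 2 powr \<gamma> * (R powr \<gamma> * M + v) * R powr (e - \<gamma>)"
        if R: "R > 0" and v: "v > 0" "G a \<le> ennreal v" for R v a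
      proof -
        \<comment> \<open>Only an inequality pointwise: \<open>norm y powr 0\<close> is 1 away from
          the origin and 0 there.\<close>
        have "(\<integral>\<^sup>+y. ennreal (norm y powr 0 * (R + norm (y - a)) powr \<gamma> * g y) \<partial>lebesgue)
          \<le> (\<integral>\<^sup>+y. ennreal ((R + norm (y - a)) powr \<gamma> * g y) \<partial>lebesgue)"
          by (intro nn_integral_mono ennreal_leI mult_right_mono) (use g0 in auto)
        also have "\<dots> \<le> ennreal (2 powr \<gamma>) * (ennreal (R powr \<gamma>) * ennreal M + G a)"
          unfolding M[symmetric] G_def
          by (rule weighted_integral_le_riesz_potential) (use meas g0 R \<gamma> in auto)
        also have "\<dots> \<le> ennreal (2 powr \<gamma>) * (ennreal (R powr \<gamma>) * ennreal M + ennreal v)"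
          by (intro mult_left_mono add_left_mono v) auto
        also have "\<dots> = ennreal (2 powr \<gamma> * (R powr \<gamma> * M + v))"
          using M0 v by (simp flip: ennreal_mult ennreal_plus)
        finally have "N \<le> K1 * (2 powr \<gamma> * (R powr \<gamma> * M + v)) * R powr (e - 0 - \<gamma>)"
          unfolding N_def using M0 v R g0
          by (intro le1[OF R _ g]) (auto intro!: mult_pos_pos add_pos_pos)
        then show ?thesis by (simp add: mult_ac)
      qed
      define m where "m = (INF y. G y)"
      have m_le: "m \<le> G y" for y by (simp add: m_def INF_lower)
      have m_fin: "m < \<infinity>" using m_le[of y] yz(2) by (rule le_less_trans)
      have m_pos: "0 < m"
      proof -
        \<comment> \<open>\<open>R\<close> makes the mass term of \<open>N_le\<close> equal to
          \<open>N / 2\<close>, and \<delta> makes the other term \<open>N / 2\<close>. A value of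
          \<open>G\<close> below \<delta> would then give \<open>N < N\<close>, so \<delta> bounds
          \<open>G\<close> below uniformly.\<close>
        define R where "R = (N / (2 * K1 * 2 powr \<gamma> * M)) powr (1 / e)"
        have R: "R > 0" using N K1 M0 by (simp add: R_def)
        have Re: "R powr e = N / (2 * K1 * 2 powr \<gamma> * M)"
          using e N K1 M0 by (simp add: R_def powr_powr)
        define \<delta> where "\<delta> = N / (2 * K1 * 2 powr \<gamma> * R powr (e - \<gamma>))"
        have \<delta>: "\<delta> > 0" using N K1 R by (simp add: \<delta>_def)
        have "ennreal \<delta> \<le> G a" for a
        proof (rule ccontr)
          assume "\<not> ennreal \<delta> \<le> G a"
          then have lt: "G a < ennreal \<delta>" by simp
          then obtain v0 where v0: "G a = ennreal v0" "0 \<le> v0" by (cases "G a") auto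
          with lt have "v0 < \<delta>" by (simp add: ennreal_less_iff)
          then obtain v where v: "v0 < v" "v < \<delta>" using dense by blast
          have "N \<le> K1 * 2 powr \<gamma> * (R powr \<gamma> * M + v) * R powr (e - \<gamma>)"
            using v v0 by (intro N_le[of _ _ a] R) (auto intro: ennreal_leI)
          also have "\<dots> < K1 * 2 powr \<gamma> * (R powr \<gamma> * M + \<delta>) * R powr (e - \<gamma>)"
            using v K1 R by simp
          also have "\<dots> = K1 * 2 powr \<gamma> * M * (R powr \<gamma> * R powr (e - \<gamma>)) + K1 * 2 powr \<gamma> * R powr (e - \<gamma>) * \<delta>"
            by (simp add: algebra_simps)
          also have "K1 * 2 powr \<gamma> * R powr (e - \<gamma>) * \<delta> = N / 2"
            using K1 R by (simp add: \<delta>_def)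
          also have "R powr \<gamma> * R powr (e - \<gamma>) = R powr e" by (simp flip: powr_add)
          also have "K1 * 2 powr \<gamma> * M * R powr e = N / 2"
            using K1 M0 by (simp add: Re)
          finally show False by simp
        qed
        then have "ennreal \<delta> \<le> m" by (simp add: m_def INF_greatest)
        with \<delta> show ?thesis by (metis ennreal_less_zero_iff less_le_trans)
      qed
      \<comment> \<open>The infimum need not be attained, but as it is positive and finite some
        \<open>a\<close> comes within a factor 2 of it.\<close>
      have "m < 2 * m"
        using m_pos m_fin by (cases m) (auto simp: ennreal_less_iff simp flip: ennreal_numeral ennreal_mult)
      then obtain a where a: "G a < 2 * m" unfolding m_def by (auto simp: INF_less_iff)
      have "G a < \<infinity>" using a m_fin by (auto intro: less_trans simp: ennreal_mult_less_top)
      then obtain v where v: "G a = ennreal v" "0 \<le> v" by (cases "G a") auto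
      have v0: "v > 0" using m_pos m_le[of a] v by (cases "v = 0") auto
      have vG: "ennreal v \<le> 2 * G y" for y
      proof -
        have "ennreal v \<le> 2 * m" using a v by simp
        also have "\<dots> \<le> 2 * G y" by (intro mult_left_mono m_le) auto
        finally show ?thesis .
      qed
      \<comment> \<open>This length balances the two terms of \<open>N_le\<close>, whose sum becomes
        \<open>2 * v\<close>.\<close>
      define R where "R = (v / M) powr (1 / \<gamma>)"
      have R: "R > 0" using v0 M0 by (simp add: R_def)
      have R\<gamma>: "R powr \<gamma> * M = v" using v0 M0 \<gamma> by (simp add: R_def powr_powr)
      \<comment> \<open>Near the centre, \<open>R powr \<gamma> * M = v\<close> is at most
        \<open>2 * G y\<close> by near-minimality; far away, the two-point estimate bounds
        \<open>norm (y - a) powr \<gamma> * M\<close> by \<open>2 powr \<gamma> * (G y + v)\<close>,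
        hence by \<open>2 powr \<gamma> * (3 * G y)\<close>. Together they give the factor
        \<open>5 * 4 powr \<gamma>\<close>.\<close>
      have low: "ennreal (c * M * (R + norm (y - a)) powr \<gamma>) \<le> G y" for y
      proof (cases "G y")
        case (real s)
        have 1: "v \<le> 2 * s" using vG[of y] real by (simp flip: ennreal_numeral ennreal_mult)
        have "ennreal (norm (y - a) powr \<gamma>) * ennreal M \<le> ennreal (2 powr \<gamma>) * (G y + G a)"
          unfolding G_def M[symmetric] by (rule riesz_potential_two_points) (use meas g0 \<gamma> in auto)
        then have 2: "norm (y - a) powr \<gamma> * M \<le> 2 powr \<gamma> * (s + v)"
          using real v v0 M0 by (simp flip: ennreal_mult ennreal_plus)
        have "2 powr \<gamma> \<ge> 1" using \<gamma> by (simp add: ge_one_powr_ge_zero)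
        have "(R + norm (y - a)) powr \<gamma> * M \<le> 2 powr \<gamma> * (R powr \<gamma> + norm (y - a) powr \<gamma>) * M"
          using M0 R \<gamma> by (intro mult_right_mono powr_add_le) auto
        also have "\<dots> = 2 powr \<gamma> * (v + norm (y - a) powr \<gamma> * M)"
          by (simp add: R\<gamma>[symmetric] algebra_simps)
        also have "\<dots> \<le> 2 powr \<gamma> * (2 * s + 2 powr \<gamma> * (s + 2 * s))"
          using 1 2 by (intro mult_left_mono add_mono order.trans[OF 2] add_left_mono) auto
        also have "\<dots> \<le> 2 powr \<gamma> * (2 powr \<gamma> * (2 * s) + 2 powr \<gamma> * (s + 2 * s))"
          using real mult_right_mono[OF \<open>2 powr \<gamma> \<ge> 1\<close>, of "2 * s"] by (intro mult_left_mono add_right_mono) auto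
        also have "\<dots> = (2 * 2) powr \<gamma> * (5 * s)"
          unfolding powr_mult by (simp add: algebra_simps)
        finally have "c * M * (R + norm (y - a)) powr \<gamma> \<le> s"
          by (simp add: c_def field_simps)
        then show ?thesis using real by (simp add: ennreal_leI)
      qed simp
      have "(\<integral>\<^sup>+y. ennreal (norm y powr \<beta> * (R + norm (y - a)) powr \<gamma> * h y) \<partial>lebesgue) \<le> ennreal (A / (c * M))"
      proof -
        have "ennreal (c * M) * (\<integral>\<^sup>+y. ennreal (norm y powr \<beta> * (R + norm (y - a)) powr \<gamma> * h y) \<partial>lebesgue)
          = (\<integral>\<^sup>+y. ennreal (norm y powr \<beta> * h y) * ennreal (c * M * (R + norm (y - a)) powr \<gamma>) \<partial>lebesgue)"
          using c M0 h0 by (subst nn_integral_cmult[symmetric]) (auto simp: mult_ac simp flip: ennreal_mult)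
        also have "\<dots> \<le> ?I"
          unfolding J by (intro nn_integral_mono mult_left_mono low) auto
        also have "\<dots> \<le> ennreal A" using IA by simp
        also have "\<dots> = ennreal (c * M) * ennreal (A / (c * M))"
          using c M0 \<open>A > 0\<close> by (simp flip: ennreal_mult)
        finally show ?thesis
          using c M0 by (subst (asm) ennreal_mult_le_mult_iff) auto
      qed
      then have "H \<le> K2 * (A / (c * M)) * R powr - e"
        unfolding H_def using c M0 \<open>A > 0\<close> by (intro le2[OF R _ h h0]) auto
      moreover have "N \<le> K1 * 2 powr \<gamma> * (2 * v) * R powr (e - \<gamma>)"
        using N_le[OF R v0 eq_refl[OF v(1)]] unfolding R\<gamma> mult_2[symmetric] .
      \<comment> \<open>Writing \<open>v\<close> as \<open>R powr \<gamma> * M\<close> turns the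
        bound into a multiple of \<open>M * R powr e\<close>, the reciprocal of the factor in the
        bound for \<open>H\<close>.\<close>
      then have "N \<le> K1 * 2 powr \<gamma> * (2 * M) * R powr e"
        using R by (simp add: R\<gamma>[symmetric] powr_diff field_simps)
      ultimately have "N * H \<le> (K1 * 2 powr \<gamma> * (2 * M) * R powr e) * (K2 * (A / (c * M)) * R powr - e)"
        using N H K1 M0 by (intro mult_mono) auto
      also have "\<dots> = 2 * K1 * K2 * 2 powr \<gamma> / c * A"
        using M0 R by (simp add: powr_minus field_simps)
      also have "\<dots> = N * H / 2"
        using K1 K2 c by (simp add: A_def C_def)
      finally show False using N H by simp
    qed
  qed
qed

section \<open>Specialisation of the exponents\<close>

theorem theorem1p1:
  fixes p q' \<alpha> :: real
  assumes "0 < p" and "p < 1"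
    and "0 < q'" and "q' < 1"
    and "\<alpha> > real CARD('n::finite)"
    and "1 / p + 1 / q' - 2 * \<alpha> / (q' * real CARD('n)) = 1"
  shows "\<exists>C::real. C > 0 \<and>
    (\<forall>(g :: real ^ 'n \<Rightarrow> real) (h :: real ^ 'n \<Rightarrow> real).
      g \<in> Lt_space q' \<longrightarrow> h \<in> Lt_space p \<longrightarrow> (\<forall>x. 0 \<le> g x) \<longrightarrow> (\<forall>y. 0 \<le> h y) \<longrightarrow>
      (\<integral>\<^sup>+ y. (\<integral>\<^sup>+ x. ennreal (norm (x - y) powr (\<alpha> / q' - real CARD('n))
                                * norm y powr (\<alpha> / q') * g x * h y) \<partial>lebesgue) \<partial>lebesgue)
        \<ge> ennreal (C * Lt_norm q' g * Lt_norm p h))"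
proof -
  define n where "n = real CARD('n)"
  have n: "n > 0" by (simp add: n_def)
  have D: "real DIM(real ^ 'n) = n" by (simp add: n_def)
  have \<alpha>: "\<alpha> > n" using assms by (simp add: n_def)
  have p: "1 / p - 1 = 2 * \<alpha> / (q' * n) - 1 / q'" using assms(6) by (simp add: n_def)
  have np: "n * (1 / p - 1) = 2 * \<alpha> / q' - n / q'"
    using n assms(3) unfolding p by (simp add: field_simps)
  \<comment> \<open>Here \<open>\<alpha> > n\<close> enters. With \<open>np\<close> it gives
    \<open>\<alpha> / q' < n * (1 / p - 1)\<close>, and with \<open>n < n / q'\<close> it makes the
    kernel exponent \<open>\<alpha> / q' - n\<close> positive.\<close>
  have nq: "n / q' < \<alpha> / q'" using \<alpha> assms(3) by (simp add: divide_strict_right_mono)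
  have "n < n / q'" using n assms(3,4) by (simp add: field_simps)
  obtain C where "C > 0" and "\<And>g h :: real ^ 'n \<Rightarrow> real.
      g \<in> Lt_space q' \<Longrightarrow> h \<in> Lt_space p \<Longrightarrow> (\<And>x. 0 \<le> g x) \<Longrightarrow> (\<And>y. 0 \<le> h y) \<Longrightarrow>
      ennreal (C * Lt_norm q' g * Lt_norm p h) \<le>
      (\<integral>\<^sup>+y. (\<integral>\<^sup>+x. ennreal (norm (x - y) powr (\<alpha> / q' - n) * norm y powr (\<alpha> / q') * g x * h y) \<partial>lebesgue) \<partial>lebesgue)"
  proof (rule reversed_Stein_Weiss[where 'a = "real ^ 'n", of p q' "\<alpha> / q' - n" "\<alpha> / q'"])
    show "0 < \<alpha> / q' - n" "0 \<le> \<alpha> / q'" using nq \<open>n < n / q'\<close> n by linarith+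
    show "\<alpha> / q' < real DIM(real ^ 'n) * (1 / p - 1)" unfolding D np using nq by simp
    show "real DIM(real ^ 'n) * (1 / p - 1) + real DIM(real ^ 'n) * (1 / q' - 1) = \<alpha> / q' + (\<alpha> / q' - n)"
      unfolding D np by (simp add: algebra_simps)
  qed (use assms in auto)
  then show ?thesis unfolding n_def by blast
qed

end
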